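(* Let $f\colon\mathbb{R}^d\to\mathbb{R}$ be a locally Lipschitz function (not necessarily convex or differentiable) that attains its global minimum, $f^*=\min_{x} f(x)$, and let $\mathcal{M}_0,\mathcal{M}_1\ge 0$. Then the condition $$\limsup_{u\to 0}\frac{1}{\|u\|}\,|f(x+u)-f(x)|\le \mathcal{M}_0+\mathcal{M}_1\,[f(x)-f^*]\qquad\text{for all }x\in\mathbb{R}^d$$ holds if and only if for all $x,x'\in\mathbb{R}^d$ $$|f(x')-f(x)|\le \Big(\frac{\mathcal{M}_0}{\mathcal{M}_1}+[f(x)-f^*]\Big)\big[\exp(\mathcal{M}_1\|x'-x\|)-1\big]\le\big(\mathcal{M}_0+\mathcal{M}_1[f(x)-f^*]\big)\exp(\mathcal{M}_1\|x'-x\|)\,\|x'-x\|.$$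
   Context: $\|\cdot\|$ is the Euclidean norm. For $\mathcal{M}_1=0$ the middle expression is understood by continuous extension, i.e. as its limit $\mathcal{M}_0\|x'-x\|$ as $\mathcal{M}_1\to+0$. *)

theory Defs
  imports "HOL-Analysis.Analysis" "HOL-Real_Asymp.Real_Asymp"
begin

(* The library's local_lipschitz is for families of functions; a single function is a constant
   family, and the index set is immaterial. *)
definition locally_lipschitz :: "('a::metric_space \<Rightarrow> 'b::metric_space) \<Rightarrow> bool" where
  "locally_lipschitz f \<longleftrightarrow> local_lipschitz {0::real} UNIV (\<lambda>_. f)"

lemma locally_lipschitz_iff:
  "locally_lipschitz f \<longleftrightarrow> (\<forall>x. \<exists>r>0. \<exists>L. L-lipschitz_on (cball x r) f)"
proof -
  have *: "(\<forall>t\<in>cball 0 r \<inter> {0::real}. P) \<longleftrightarrow> P" if "r > 0" for r P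
    using that by auto
  show ?thesis
    unfolding locally_lipschitz_def local_lipschitz_def using * by (simp cong: conj_cong)
qed

(* The real type is not a complete lattice, so the upper limit is taken in ereal, where it may
   be infinite. The filter at 0 excludes u = 0. *)
definition upper_slope :: "('a::real_normed_vector \<Rightarrow> real) \<Rightarrow> 'a \<Rightarrow> ereal" where
  "upper_slope f x = Limsup (at 0) (\<lambda>u. ereal (1 / norm u * \<bar>f (x + u) - f x\<bar>))"

(* The expression (M0 / M1 + g) * (exp (M1 * t) - 1), extended continuously to M1 = 0: without
   the case distinction, M0 / 0 = 0 would give the value 0 there.
   The extension is justified by exp_growth_bound_tendsto below. *)
definition exp_growth_bound :: "real \<Rightarrow> real \<Rightarrow> real \<Rightarrow> real \<Rightarrow> real" where
  "exp_growth_bound M0 M1 g t =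
     (if M1 = 0 then M0 * t else (M0 / M1 + g) * (exp (M1 * t) - 1))"

lemma exp_growth_bound_tendsto:
  "((\<lambda>M1. (M0 / M1 + g) * (exp (M1 * t) - 1)) \<longlongrightarrow> exp_growth_bound M0 0 g t) (at_right 0)"
  unfolding exp_growth_bound_def by real_asymp

end

theory Submission imports Defs begin

text \<open>
  Suppose first that \<open>M1 > 0\<close>. Then \<open>h = M0 / M1 + (f - fstar)\<close> is nonnegative and the slope
  condition says that its upper slope is at most \<open>M1 * h\<close>. Hence \<open>h * exp (- M1 * t)\<close> has
  nonpositive upper right Dini derivative along every unit speed segment, so it is nonincreasing,
  which bounds \<open>h x'\<close> by \<open>h x * exp (M1 * norm (x' - x))\<close>. Exchanging \<open>x\<close> and \<open>x'\<close> gives the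
  other half of the bound on the absolute value. As \<open>f - fstar\<close> is nonnegative, the slope
  condition for \<open>M1 = 0\<close> implies the one for every \<open>M1 > 0\<close>, and the limit \<open>M1 \<rightarrow> 0\<close> settles
  that case. Conversely, divide the bound by \<open>norm (x' - x)\<close> and let \<open>x'\<close> tend to \<open>x\<close>.
\<close>

text \<open>For fixed \<open>e > 0\<close> the points \<open>s\<close> with
  \<open>F s - F a <= e * (s - a)\<close> form a compact set containing \<open>a\<close>. Its
  maximum is \<open>b\<close>, since the Dini bound at an earlier point would yield a later member.
  Then \<open>e\<close> tends to 0.\<close>

lemma Dini_nonpos_imp_le:
  fixes F :: "real \<Rightarrow> real"
  assumes "a \<le> b" and cont: "continuous_on {a..b} F"
    and Dini: "\<And>t e. \<lbrakk>a \<le> t; t < b; e > 0\<rbrakk> \<Longrightarrow> \<forall>\<^sub>F s in at_right t. F s - F t \<le> e * (s - t)"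
  shows "F b \<le> F a"
proof -
  have *: "F b - F a \<le> e * (b - a)" if "e > 0" for e
  proof -
    define S where "S = {s \<in> {a..b}. F s - F a \<le> e * (s - a)}"
    have "closed S"
      unfolding S_def
      by (intro continuous_on_closed_Collect_le continuous_intros cont closed_real_atLeastAtMost)
    moreover have "S \<subseteq> {a..b}"
      by (auto simp: S_def)
    ultimately have "compact S"
      by (metis bounded_closed_interval bounded_subset compact_eq_bounded_closed)
    moreover have "a \<in> S"
      using \<open>a \<le> b\<close> by (simp add: S_def)
    ultimately obtain c where c: "c \<in> S" "\<And>s. s \<in> S \<Longrightarrow> s \<le> c"
      by (metis compact_attains_sup empty_iff)
    have "c = b"
    proof (rule ccontr)
      assume "c \<noteq> b"
      with c have cb: "a \<le> c" "c < b"
        by (auto simp: S_def)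
      \<comment> \<open>Increments add up: slope at most \<open>e\<close> from \<open>a\<close> to
        \<open>c\<close> and from \<open>c\<close> to \<open>s\<close> gives slope at most
        \<open>e\<close> from \<open>a\<close> to \<open>s\<close>.\<close>
      have "\<forall>\<^sub>F s in at_right c. s \<in> {c<..<b} \<and> F s - F c \<le> e * (s - c)"
        using eventually_at_right_real[OF cb(2)] Dini[OF cb \<open>e > 0\<close>] by (rule eventually_conj)
      then obtain s where s: "c < s" "s < b" "F s - F c \<le> e * (s - c)"
        by (auto dest!: eventually_happens)
      then have "s \<in> S"
        using c(1) by (auto simp: S_def algebra_simps)
      then show False
        using c(2) s(1) by fastforce
    qed
    then show ?thesis
      using c(1) by (simp add: S_def)
  qed
  have "((\<lambda>e. e * (b - a)) \<longlongrightarrow> 0 * (b - a)) (at_right (0::real))"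
    by (intro tendsto_intros)
  then have "F b - F a \<le> 0 * (b - a)"
    by (rule tendsto_lowerbound)
      (auto simp: eventually_at_right_less intro: eventually_mono[OF eventually_at_right_less] *)
  then show ?thesis
    by simp
qed

text \<open>The integrating factor \<open>exp (- K * t)\<close> reduces the claim to the
  monotonicity criterion above. The Dini bound replaces a derivative, which need not exist.\<close>

lemma Dini_gronwall:
  fixes h :: "real \<Rightarrow> real"
  assumes "0 \<le> b" "K \<ge> 0" and cont: "continuous_on {0..b} h" and pos: "\<And>t. h t \<ge> 0"
    and Dini: "\<And>t e. \<lbrakk>0 \<le> t; t < b; e > 0\<rbrakk> \<Longrightarrow>
      \<forall>\<^sub>F s in at_right t. h s - h t \<le> (K * h t + e) * (s - t)"
  shows "h b \<le> h 0 * exp (K * b)"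
proof -
  have "h b * exp (- K * b) \<le> h 0 * exp (- K * 0)"
  proof (rule Dini_nonpos_imp_le[where a = 0 and b = b and F = "\<lambda>t. h t * exp (- K * t)"])
    fix t e :: real
    assume t: "0 \<le> t" "t < b" "e > 0"
    have "\<forall>\<^sub>F s in at_right t. s > t \<and> h s - h t \<le> (K * h t + e) * (s - t)"
      using eventually_at_right_less Dini[OF t] by (rule eventually_conj)
    then show "\<forall>\<^sub>F s in at_right t. h s * exp (- K * s) - h t * exp (- K * t) \<le> e * (s - t)"
    proof (rule eventually_mono, elim conjE)
      fix s
      assume s: "t < s" "h s - h t \<le> (K * h t + e) * (s - t)"
      \<comment> \<open>The tangent line bound for \<open>exp\<close> absorbs the term
        \<open>K * h t * (s - t)\<close>. Multiplying it by \<open>h t\<close> needs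
        \<open>h\<close> nonnegative.\<close>
      have "exp (- K * s) * (1 + K * (s - t)) \<le> exp (- K * s) * exp (K * (s - t))"
        by (intro mult_left_mono exp_ge_add_one_self) auto
      also have "\<dots> = exp (- K * t)"
        by (simp add: mult_exp_exp algebra_simps)
      finally have "h t * (exp (- K * s) * (1 + K * (s - t))) \<le> h t * exp (- K * t)"
        by (intro mult_left_mono pos)
      moreover have "exp (- K * s) * (h s - h t) \<le> exp (- K * s) * ((K * h t + e) * (s - t))"
        using s by (intro mult_left_mono) auto
      \<comment> \<open>The weight is at most 1 because \<open>s > t \<ge> 0\<close>, so the error
        stays below \<open>e * (s - t)\<close>.\<close>
      moreover have "exp (- K * s) * (e * (s - t)) \<le> 1 * (e * (s - t))"
        using s t \<open>K \<ge> 0\<close> by (intro mult_right_mono) auto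
      ultimately show "h s * exp (- K * s) - h t * exp (- K * t) \<le> e * (s - t)"
        by (simp add: algebra_simps)
    qed
  qed (use assms in \<open>auto intro!: continuous_intros\<close>)
  then have "h b * exp (- K * b) * exp (K * b) \<le> h 0 * exp (K * b)"
    by (intro mult_right_mono) auto
  then show ?thesis
    by (simp add: mult.assoc mult_exp_exp)
qed

lemma locally_lipschitz_imp_continuous_on:
  assumes "locally_lipschitz f"
  shows "continuous_on A f"
proof -
  have "isCont f x" for x
  proof -
    obtain r L where "r > 0" "L-lipschitz_on (cball x r) f"
      using assms unfolding locally_lipschitz_iff by blast
    then have "continuous_on (ball x r) f"
      using lipschitz_on_continuous_on continuous_on_subset ball_subset_cball by blast
    then show ?thesis
      using \<open>r > 0\<close> by (simp add: continuous_on_eq_continuous_at)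
  qed
  then show ?thesis
    by (simp add: continuous_at_imp_continuous_on)
qed

text \<open>The slack \<open>e\<close> makes the inequality for the \<open>Limsup\<close> strict,
  hence eventually true. At \<open>u = 0\<close> both sides vanish, so the full neighbourhood filter
  is allowed, which makes composition with limits easy.\<close>

lemma upper_slope_leD:
  assumes "upper_slope f x \<le> ereal c" "e > 0"
  shows "\<forall>\<^sub>F u in nhds 0. \<bar>f (x + u) - f x\<bar> \<le> (c + e) * norm u"
proof -
  have "upper_slope f x < ereal (c + e)"
    using assms by (simp add: order.strict_trans1)
  then have "\<forall>\<^sub>F u in at 0. ereal (1 / norm u * \<bar>f (x + u) - f x\<bar>) < ereal (c + e)"
    unfolding upper_slope_def by (rule Limsup_lessD)
  then show ?thesis
    unfolding eventually_at_filter
    by (rule eventually_mono) (force simp: field_simps)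
qed

text \<open>In a perfect space the filter \<open>at 0\<close> is nontrivial, so the
  \<open>Limsup\<close> of \<open>g\<close> is its limit.\<close>

lemma upper_slope_leI:
  fixes f :: "'a::{real_normed_vector, perfect_space} \<Rightarrow> real"
  assumes le: "\<And>u. \<bar>f (x + u) - f x\<bar> \<le> g u * norm u" and lim: "(g \<longlongrightarrow> c) (at 0)"
  shows "upper_slope f x \<le> ereal c"
proof -
  have "\<forall>\<^sub>F u in at 0. ereal (1 / norm u * \<bar>f (x + u) - f x\<bar>) \<le> ereal (g u)"
    unfolding eventually_at_filter
    using le by (intro always_eventually) (simp add: divide_le_eq)
  then have "upper_slope f x \<le> Limsup (at 0) (\<lambda>u. ereal (g u))"
    unfolding upper_slope_def by (rule Limsup_mono)
  also have "\<dots> = ereal c"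
    using lim by (intro lim_imp_Limsup) auto
  finally show ?thesis .
qed

lemma upper_slope_gronwall:
  fixes h :: "'a::real_normed_vector \<Rightarrow> real"
  assumes "continuous_on UNIV h" "K \<ge> 0" and pos: "\<And>x. h x \<ge> 0"
    and slope: "\<And>x. upper_slope h x \<le> ereal (K * h x)"
  shows "h y \<le> h x * exp (K * norm (y - x))"
proof (cases "y = x")
  case False
  \<comment> \<open>Unit speed turns \<open>norm u\<close> in the slope bound into
    \<open>s - t\<close>, and \<open>p\<close> reaches \<open>y\<close> at time
    \<open>norm (y - x)\<close>.\<close>
  define p where "p t = x + t *\<^sub>R sgn (y - x)" for t
  have n: "norm (sgn (y - x)) = 1"
    using False by (simp add: norm_sgn)
  have "(h \<circ> p) (norm (y - x)) \<le> (h \<circ> p) 0 * exp (K * norm (y - x))"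
  proof (rule Dini_gronwall)
    show "continuous_on {0..norm (y - x)} (h \<circ> p)"
      unfolding p_def
      by (intro continuous_on_compose continuous_on_subset[OF assms(1)] continuous_intros) auto
  next
    fix t e :: real
    assume "e > 0"
    have "((\<lambda>s. (s - t) *\<^sub>R sgn (y - x)) \<longlongrightarrow> (t - t) *\<^sub>R sgn (y - x)) (at_right t)"
      by (intro tendsto_intros)
    then have "filterlim (\<lambda>s. (s - t) *\<^sub>R sgn (y - x)) (nhds 0) (at_right t)"
      by simp
    from eventually_compose_filterlim[OF upper_slope_leD[OF slope \<open>e > 0\<close>] this]
    have "\<forall>\<^sub>F s in at_right t. \<bar>h (p t + (s - t) *\<^sub>R sgn (y - x)) - h (p t)\<bar>
        \<le> (K * h (p t) + e) * norm ((s - t) *\<^sub>R sgn (y - x))" .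
    then show "\<forall>\<^sub>F s in at_right t. (h \<circ> p) s - (h \<circ> p) t \<le> (K * (h \<circ> p) t + e) * (s - t)"
      using eventually_at_right_less[of t]
    proof eventually_elim
      case (elim s)
      have "p t + (s - t) *\<^sub>R sgn (y - x) = p s"
        by (simp add: p_def algebra_simps)
      with elim show ?case
        by (simp add: n)
    qed
  qed (use assms in auto)
  then show ?thesis
    using False by (simp add: p_def sgn_div_norm)
qed simp

lemma upper_slope_add_const: "upper_slope (\<lambda>x. c + f x) = upper_slope f"
  by (simp add: upper_slope_def fun_eq_iff)

lemma exp_growth_bound_if_upper_slope:
  fixes f :: "'a::real_normed_vector \<Rightarrow> real"
  assumes cont: "continuous_on UNIV f" and min: "\<And>x. fstar \<le> f x" and "M0 \<ge> 0" "M1 > 0"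
    and slope: "\<And>x. upper_slope f x \<le> ereal (M0 + M1 * (f x - fstar))"
  shows "\<bar>f y - f x\<bar> \<le> exp_growth_bound M0 M1 (f x - fstar) (norm (y - x))"
proof -
  \<comment> \<open>The additive constant is chosen so that the slope bound becomes the homogeneous
    \<open>M1 * h x\<close>; it leaves the upper slope unchanged.\<close>
  define h where "h x = (M0 / M1 - fstar) + f x" for x
  have pos: "h x \<ge> 0" for x
    using min[of x] divide_nonneg_pos[OF assms(3,4)] unfolding h_def by linarith
  have up: "h y \<le> h x * exp (M1 * norm (y - x))" for x y
  proof (rule upper_slope_gronwall)
    fix x
    have "M0 + M1 * (f x - fstar) = M1 * h x"
      using \<open>M1 > 0\<close> by (simp add: h_def field_simps)
    then show "upper_slope h x \<le> ereal (M1 * h x)"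
      using slope[of x] by (simp add: h_def[abs_def] upper_slope_add_const)
  qed (use cont pos \<open>M1 > 0\<close> in \<open>auto simp: h_def[abs_def] intro!: continuous_intros\<close>)
  define E where "E = exp (M1 * norm (y - x))"
  have "E \<ge> 1"
    using \<open>M1 > 0\<close> by (simp add: E_def)
  have yx: "h y \<le> h x * E" and xy: "h x \<le> h y * E"
    using up[of y x] up[of x y] by (auto simp: E_def norm_minus_commute)
  \<comment> \<open>Exchanging the points bounds the left side by \<open>h y * (E - 1)\<close>. The
    factor \<open>h y\<close> may be replaced by \<open>h x\<close> if it is smaller; otherwise the
    left side is at most 0.\<close>
  have "h x - h y \<le> h x * (E - 1)"
  proof (cases "h x \<le> h y")
    case True
    then show ?thesis
      using mult_nonneg_nonneg[OF pos[of x], of "E - 1"] \<open>E \<ge> 1\<close> by linarith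
  next
    case False
    then have "h y * (E - 1) \<le> h x * (E - 1)"
      using \<open>E \<ge> 1\<close> by (intro mult_right_mono) auto
    then show ?thesis
      using xy by (simp add: algebra_simps)
  qed
  then have "\<bar>h y - h x\<bar> \<le> h x * (E - 1)"
    using yx by (simp add: abs_le_iff algebra_simps)
  then show ?thesis
    using \<open>M1 > 0\<close> by (simp add: exp_growth_bound_def h_def E_def algebra_simps)
qed

text \<open>With \<open>s = M1 * t\<close>, multiplying \<open>1 - s \<le> exp (- s)\<close> by
  \<open>exp s\<close> gives \<open>exp s - 1 \<le> s * exp s\<close>. For \<open>M1 = 0\<close>
  both sides equal \<open>M0 * t\<close>.\<close>

lemma exp_growth_bound_le:
  assumes "M0 \<ge> 0" "M1 \<ge> 0" "g \<ge> 0"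
  shows "exp_growth_bound M0 M1 g t \<le> (M0 + M1 * g) * exp (M1 * t) * t"
proof (cases "M1 = 0")
  case False
  then have "M1 > 0"
    using assms by simp
  have "exp (M1 * t) * (1 - M1 * t) \<le> exp (M1 * t) * exp (- (M1 * t))"
    using exp_ge_add_one_self[of "- (M1 * t)"] by (intro mult_left_mono) auto
  then have "exp (M1 * t) - 1 \<le> M1 * t * exp (M1 * t)"
    by (simp add: mult_exp_exp algebra_simps)
  then have "(M0 / M1 + g) * (exp (M1 * t) - 1) \<le> (M0 / M1 + g) * (M1 * t * exp (M1 * t))"
    using assms by (intro mult_left_mono) auto
  also have "\<dots> = (M0 + M1 * g) * exp (M1 * t) * t"
    using False by (simp add: field_simps)
  finally show ?thesis
    using False by (simp add: exp_growth_bound_def)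
qed (simp add: exp_growth_bound_def)

theorem lemma1:
  fixes f :: "real ^ 'd \<Rightarrow> real" and fstar M0 M1 :: real
  assumes "locally_lipschitz f"
    and "fstar \<in> range f" and "\<And>x. fstar \<le> f x"
    and "M0 \<ge> 0" and "M1 \<ge> 0"
  shows "(\<forall>x. upper_slope f x \<le> ereal (M0 + M1 * (f x - fstar))) \<longleftrightarrow>
    (\<forall>x x'.
      \<bar>f x' - f x\<bar> \<le> exp_growth_bound M0 M1 (f x - fstar) (norm (x' - x)) \<and>
      exp_growth_bound M0 M1 (f x - fstar) (norm (x' - x))
        \<le> (M0 + M1 * (f x - fstar)) * exp (M1 * norm (x' - x)) * norm (x' - x))"
    (is "?slope \<longleftrightarrow> ?growth")
proof
  assume slope: ?slope
  note cont = locally_lipschitz_imp_continuous_on[OF assms(1), of UNIV]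
  have "\<bar>f x' - f x\<bar> \<le> exp_growth_bound M0 M1 (f x - fstar) (norm (x' - x))" for x x'
  proof (cases "M1 = 0")
    case True
    have "\<bar>f x' - f x\<bar> \<le> (M0 / m + (f x - fstar)) * (exp (m * norm (x' - x)) - 1)"
      if "m > 0" for m
    proof -
      have "upper_slope f z \<le> ereal (M0 + m * (f z - fstar))" for z
      proof -
        have "upper_slope f z \<le> ereal M0"
          using slope True by simp
        also have "\<dots> \<le> ereal (M0 + m * (f z - fstar))"
          using assms(3)[of z] that by simp
        finally show ?thesis .
      qed
      then show ?thesis
        using exp_growth_bound_if_upper_slope[OF cont assms(3,4) that, of x' x] that
        by (simp add: exp_growth_bound_def)
    qed
    then have "\<bar>f x' - f x\<bar> \<le> exp_growth_bound M0 0 (f x - fstar) (norm (x' - x))"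
      by (intro tendsto_lowerbound[OF exp_growth_bound_tendsto]
          eventually_mono[OF eventually_at_right_less]) auto
    then show ?thesis
      using True by simp
  next
    case False
    then show ?thesis
      using slope assms(5) by (intro exp_growth_bound_if_upper_slope[OF cont assms(3,4)]) auto
  qed
  then show ?growth
    using exp_growth_bound_le[OF assms(4,5)] assms(3) by simp
next
  assume growth: ?growth
  show ?slope
  proof
    fix x
    show "upper_slope f x \<le> ereal (M0 + M1 * (f x - fstar))"
    \<comment> \<open>The outermost bound of the chain already has the factor \<open>norm u\<close>,
      so division is immediate and \<open>M1 = 0\<close> needs no separate case.\<close>
    proof (rule upper_slope_leI)
      fix u
      show "\<bar>f (x + u) - f x\<bar> \<le> (M0 + M1 * (f x - fstar)) * exp (M1 * norm u) * norm u"
        using growth[rule_format, of "x + u" x] by simp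
      have "((\<lambda>u::real^'d. (M0 + M1 * (f x - fstar)) * exp (M1 * norm u))
          \<longlongrightarrow> (M0 + M1 * (f x - fstar)) * exp (M1 * norm (0::real^'d))) (at 0)"
        by (intro tendsto_intros)
      then show "((\<lambda>u::real^'d. (M0 + M1 * (f x - fstar)) * exp (M1 * norm u))
          \<longlongrightarrow> M0 + M1 * (f x - fstar)) (at 0)"
        by simp
    qed
  qed
qed

end
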